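(* Let $w\in\mathbb R^n_{++}$, $b\in\mathbb R^n_{++}$ and $c>0$ with $c<\sum_{i=1}^n w_i b_i$, and set $W_{sum}=\sum_{i=1}^n w_i$. Consider the problems $$\text{(P)}\quad \min_{x\in\mathbb R^n}\ \sum_{i=1}^n w_i x_i^2\quad\text{s.t.}\quad \sum_{i=1}^n w_i x_i=c,\quad x\le b,$$ $$\text{(ZWMVA)}\quad \min_{x\in\mathbb R^n}\ \sum_{i=1}^n w_i\Bigl(x_i-\frac{c}{W_{sum}}\Bigr)^2\quad\text{s.t.}\quad \sum_{i=1}^n w_i x_i=c,\quad 0\le x\le b.$$ Then every optimal solution of (P) is nonnegative. Consequently, (P) and (ZWMVA) have the same set of optimal solutions.
   Context: $\mathbb R^n_{++}$ denotes the set of vectors with strictly positive entries; vector inequalities are componentwise. *)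

theory Defs
  imports "HOL-Analysis.Analysis"
begin

(* The order x \<le> y on real ^ 'n is the componentwise one. The library's strict order is not
   (x < y means x \<le> y and x \<noteq> y), so strict positivity is defined entrywise. *)
definition strictly_positive :: "real ^ 'n \<Rightarrow> bool" where
  "strictly_positive v \<longleftrightarrow> (\<forall>i. 0 < v $ i)"

definition W_sum :: "real ^ 'n \<Rightarrow> real" where
  "W_sum w = (\<Sum>i\<in>UNIV. w $ i)"

definition P_objective :: "real ^ 'n \<Rightarrow> real ^ 'n \<Rightarrow> real" where
  "P_objective w x = (\<Sum>i\<in>UNIV. w $ i * (x $ i)\<^sup>2)"

definition P_feasible :: "real ^ 'n \<Rightarrow> real ^ 'n \<Rightarrow> real \<Rightarrow> real ^ 'n \<Rightarrow> bool" where
  "P_feasible w b c x \<longleftrightarrow> (\<Sum>i\<in>UNIV. w $ i * x $ i) = c \<and> x \<le> b"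

definition ZWMVA_objective :: "real ^ 'n \<Rightarrow> real \<Rightarrow> real ^ 'n \<Rightarrow> real" where
  "ZWMVA_objective w c x = (\<Sum>i\<in>UNIV. w $ i * (x $ i - c / W_sum w)\<^sup>2)"

definition ZWMVA_feasible :: "real ^ 'n \<Rightarrow> real ^ 'n \<Rightarrow> real \<Rightarrow> real ^ 'n \<Rightarrow> bool" where
  "ZWMVA_feasible w b c x \<longleftrightarrow> (\<Sum>i\<in>UNIV. w $ i * x $ i) = c \<and> 0 \<le> x \<and> x \<le> b"

(* Global minimizers: is_arg_min f Q x says that Q x holds and no y with Q y has f y < f x. *)
definition P_solutions :: "real ^ 'n \<Rightarrow> real ^ 'n \<Rightarrow> real \<Rightarrow> (real ^ 'n) set" where
  "P_solutions w b c = {x. is_arg_min (P_objective w) (P_feasible w b c) x}"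

definition ZWMVA_solutions :: "real ^ 'n \<Rightarrow> real ^ 'n \<Rightarrow> real \<Rightarrow> (real ^ 'n) set" where
  "ZWMVA_solutions w b c = {x. is_arg_min (ZWMVA_objective w c) (ZWMVA_feasible w b c) x}"

end

theory Submission
  imports Defs
begin

text \<open>Replacing the negative entries of a feasible point of (P) by \<open>0\<close> raises the weighted sum, so
  scaling by a factor in \<open>(0, 1]\<close> restores it. Both steps keep the point below \<open>b\<close> and do not
  increase the objective, the first one strictly decreasing it if there was a negative entry. So
  feasible points with a negative entry may be ignored in (P), and on the hyperplane
  \<open>\<Sum>i. w\<^sub>i x\<^sub>i = c\<close> the two objectives differ by the constant \<open>c\<^sup>2 / W\<^sub>s\<^sub>u\<^sub>m\<close>.\<close>

lemma W_sum_pos: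
  assumes "strictly_positive w"
  shows "0 < W_sum w"
  using assms unfolding W_sum_def strictly_positive_def by (intro sum_pos) auto

text \<open>On this hyperplane \<open>c / W_sum w\<close> is the weighted mean of the entries of
  \<open>x\<close>, so this is the usual variance identity: the cross term depends only on the
  weighted sum.\<close>

lemma ZWMVA_objective_eq:
  assumes w: "strictly_positive w" and c: "(\<Sum>i\<in>UNIV. w $ i * x $ i) = c"
  shows "ZWMVA_objective w c x = P_objective w x - c\<^sup>2 / W_sum w"
proof -
  define m where "m = c / W_sum w"
  have "ZWMVA_objective w c x =
      (\<Sum>i\<in>UNIV. w $ i * (x $ i)\<^sup>2 - 2 * m * (w $ i * x $ i) + m\<^sup>2 * w $ i)"
    unfolding ZWMVA_objective_def m_def[symmetric]
    by (intro sum.cong) (auto simp: power2_eq_square algebra_simps)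
  also have "\<dots> = P_objective w x - 2 * m * c + m\<^sup>2 * W_sum w"
    by (simp add: sum.distrib sum_subtractf P_objective_def W_sum_def c flip: sum_distrib_left)
  also have "\<dots> = P_objective w x - c\<^sup>2 / W_sum w"
    using W_sum_pos[OF w] by (simp add: m_def power2_eq_square field_simps)
  finally show ?thesis .
qed

lemma P_objective_scaleR: "P_objective w (t *\<^sub>R x) = t\<^sup>2 * P_objective w x"
  by (simp add: P_objective_def power_mult_distrib sum_distrib_left mult.left_commute)

text \<open>The better point is feasible even for the smaller problem, so it can be compared with
  minimizers of either one.\<close>

lemma P_feasible_negative_improvable:
  fixes w b x :: "real ^ 'n"
  assumes w: "strictly_positive w" and b: "strictly_positive b" and c: "0 < c"
    and x: "P_feasible w b c x" and neg: "\<not> 0 \<le> x"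
  obtains z where "ZWMVA_feasible w b c z" "P_objective w z < P_objective w x"
proof -
  define y where "y = (\<chi> i. max 0 (x $ i))"
  define s where "s = (\<Sum>i\<in>UNIV. w $ i * y $ i)"
  define t where "t = c / s"
  have wpos: "0 < w $ i" for i
    using w by (simp add: strictly_positive_def)
  have "(\<Sum>i\<in>UNIV. w $ i * x $ i) \<le> s"
    unfolding s_def
    by (intro sum_mono mult_left_mono) (auto simp: y_def wpos less_imp_le)
  then have "c \<le> s"
    using x by (simp add: P_feasible_def)
  \<comment> \<open>Since \<open>c\<close> is positive, so is \<open>s\<close>, and the quotient
    \<open>c / s\<close> is not a division by zero.\<close>
  with c have t: "0 < t" "t \<le> 1" "t * s = c"
    by (auto simp: t_def)
  \<comment> \<open>Entries raised to 0 stay below the bound because \<open>b\<close> is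
    positive.\<close>
  have y: "0 \<le> y $ i" "y $ i \<le> b $ i" for i
    using x b by (auto simp: y_def P_feasible_def strictly_positive_def less_eq_vec_def less_imp_le)
  have "t * y $ i \<le> b $ i" for i
    using mult_right_mono[OF t(2) y(1)[of i]] y(2)[of i] by simp
  moreover have "(\<Sum>i\<in>UNIV. w $ i * (t * y $ i)) = t * s"
    by (simp add: s_def sum_distrib_left mult.left_commute)
  ultimately have feas: "ZWMVA_feasible w b c (t *\<^sub>R y)"
    using t y by (simp add: ZWMVA_feasible_def less_eq_vec_def)
  obtain j where j: "x $ j < 0"
    using neg by (auto simp: less_eq_vec_def not_le)
  have "P_objective w y < P_objective w x"
    unfolding P_objective_def
  proof (rule sum_strict_mono_ex1)
    show "\<forall>i\<in>UNIV. w $ i * (y $ i)\<^sup>2 \<le> w $ i * (x $ i)\<^sup>2"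
      using wpos by (auto simp: y_def max_def less_imp_le)
    show "\<exists>i\<in>UNIV. w $ i * (y $ i)\<^sup>2 < w $ i * (x $ i)\<^sup>2"
      using wpos[of j] j by (intro bexI[of _ j]) (auto simp: y_def max_def)
  qed simp
  moreover have "P_objective w (t *\<^sub>R y) \<le> P_objective w y"
  proof -
    have "0 \<le> P_objective w y"
      using wpos by (auto simp: P_objective_def less_imp_le intro!: sum_nonneg)
    then show ?thesis
      using t by (simp add: P_objective_scaleR mult_left_le_one_le power_le_one)
  qed
  ultimately show thesis
    using feas that by fastforce
qed

theorem theorem3:
  fixes w b :: "real ^ 'n" and c :: real
  assumes "strictly_positive w"
    and "strictly_positive b"
    and "0 < c"
    and "c < (\<Sum>i\<in>UNIV. w $ i * b $ i)"
  shows "(\<forall>x \<in> P_solutions w b c. 0 \<le> x) \<and> P_solutions w b c = ZWMVA_solutions w b c"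
proof -
  have feas_iff: "ZWMVA_feasible w b c x \<longleftrightarrow> P_feasible w b c x \<and> 0 \<le> x" for x
    by (auto simp: ZWMVA_feasible_def P_feasible_def)
  have obj: "ZWMVA_objective w c x = P_objective w x - c\<^sup>2 / W_sum w"
    if "P_feasible w b c x" for x
    using that assms(1) by (intro ZWMVA_objective_eq) (auto simp: P_feasible_def)
  have improve: "\<exists>z. ZWMVA_feasible w b c z \<and> P_objective w z < P_objective w x"
    if "P_feasible w b c x" "\<not> 0 \<le> x" for x
    using P_feasible_negative_improvable[OF assms(1-3) that] by blast
  have nonneg: "0 \<le> x" if "x \<in> P_solutions w b c" for x
    using that improve feas_iff unfolding P_solutions_def is_arg_min_def by blast
  have "x \<in> P_solutions w b c \<longleftrightarrow> x \<in> ZWMVA_solutions w b c" for x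
  proof
    assume x: "x \<in> P_solutions w b c"
    \<comment> \<open>A minimizer over the larger feasible set that lies in the smaller one is a
      minimizer there, and the constant shift in \<open>obj\<close> preserves comparisons.\<close>
    with nonneg[OF x] show "x \<in> ZWMVA_solutions w b c"
      by (auto simp: P_solutions_def ZWMVA_solutions_def is_arg_min_def feas_iff obj)
  next
    assume "x \<in> ZWMVA_solutions w b c"
    then have x: "P_feasible w b c x"
      and min: "\<And>z. ZWMVA_feasible w b c z \<Longrightarrow> P_objective w x \<le> P_objective w z"
      by (auto simp: ZWMVA_solutions_def is_arg_min_def feas_iff obj not_less)
    have "P_objective w x \<le> P_objective w y" if y: "P_feasible w b c y" for y
    proof (cases "0 \<le> y")
      case True
      with y min feas_iff show ?thesis by blast
    next
      case False
      \<comment> \<open>Here \<open>min\<close> does not apply to \<open>y\<close> itself, but it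
        does to the better nonnegative point: \<open>x\<close> is at most that point, which is below
        \<open>y\<close>.\<close>
      with improve[OF y] min show ?thesis by fastforce
    qed
    with x show "x \<in> P_solutions w b c"
      by (auto simp: P_solutions_def is_arg_min_def not_less)
  qed
  with nonneg show ?thesis by blast
qed

end
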